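(* Let $n\ge 1$ be an integer and let $K$ be a field whose characteristic is either $0$ or a positive number relatively prime to $n$. Let $a,b\in K\setminus\{0\}$ with $a\neq b$. Let $x_1,\ldots,x_n$ and $y_1,\ldots,y_n$ be the distinct roots of the polynomials $x^n+a$ and $x^n+b$, respectively, in the splitting field of $(x^n+a)(x^n+b)$ over $K$. Then $$\operatorname{per}\left(\left(\frac{1}{x_i-y_j}\right)_{1\le i,j\le n}\right)=\frac{n}{(b-a)^n}\prod_{k=1}^{n-1}[na+k(b-a)]=\frac{n}{(b-a)^n}\prod_{k=1}^{n-1}[nb+k(a-b)],$$ and this common value equals $$\begin{cases}(-1)^{\frac{n-1}{2}}\dfrac{n}{(b-a)^n}\displaystyle\prod_{k=1}^{\frac{n-1}{2}}[-na-k(b-a)]\,[nb-k(b-a)], & \text{if } n\equiv 1 \pmod 2,\\[2ex] \dfrac{n}{2}\cdot\dfrac{n(a+b)}{(b-a)^n}\displaystyle\prod_{k=1}^{\frac n2-1}[na+k(b-a)]\,[nb+k(a-b)], & \text{if } n\equiv 0\pmod 2.\end{cases}$$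
   Context: For an $n\times n$ matrix $A=(a_{i,j})$ over a commutative ring, the permanent is $\operatorname{per}(A)=\sum_{\sigma\in \mathrm{Sym}(n)}\prod_{i=1}^n a_{i,\sigma(i)}$, where $\mathrm{Sym}(n)$ is the symmetric group on $\{1,\ldots,n\}$. Empty products equal $1$. *)

theory Defs
  imports
    "Jordan_Normal_Form.Matrix"
    "HOL-Algebra.Algebraic_Closure_Type"
    "HOL-Algebra.Generated_Fields"
    "HOL-Computational_Algebra.Polynomial"
begin

definition permanent :: "'a mat \<Rightarrow> 'a :: comm_ring_1" where
  "permanent A = (if dim_row A = dim_col A then (\<Sum> p \<in> {p. p permutes {0 ..< dim_row A}}.
     \<Prod> i = 0 ..< dim_row A. A $$ (i, p i)) else 0)"

(* The field K is the type 'k. A splitting field of p over K is a subfield L of an ambient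
   field 'l, together with an embedding h of K, such that p factors into linear factors over L
   and L is generated by K and the roots of p. Making L a set rather than a type lets it
   depend on p. *)
definition is_splitting_field :: "('k :: field \<Rightarrow> 'l :: field) \<Rightarrow> 'k poly \<Rightarrow> 'l set \<Rightarrow> bool" where
  "is_splitting_field h p L \<longleftrightarrow> field_hom h \<and> p \<noteq> 0 \<and>
     (\<exists>rs. set rs \<subseteq> L \<and>
        map_poly h p = smult (h (lead_coeff p)) (\<Prod>r\<leftarrow>rs. [:- r, 1:]) \<and>
        L = generate_field ring_of_type_algebra (range h \<union> set rs))"

end

theory Submission
  imports Defs "Jordan_Normal_Form.Determinant"
begin

text \<open>
  Let \<open>C\<close> be the Cauchy matrix with entries \<open>1 / (x\<^sub>i - y\<^sub>j)\<close>. Borchardt's identity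
  (\<open>borchardt_identity\<close>) states that \<open>det C\<close> times the permanent of \<open>C\<close> is the determinant of the
  matrix \<open>S\<close> with entries \<open>1 / (x\<^sub>i - y\<^sub>j)\<^sup>2\<close>. So the permanent is a quotient of two determinants, as
  soon as \<open>det C\<close> is not zero.

  The roots satisfy \<open>x\<^sub>i\<^sup>n - y\<^sub>j\<^sup>n = b - a\<close>, whence
  \<open>1 / (x\<^sub>i - y\<^sub>j)\<close> is \<open>1 / (b - a)\<close> times the sum of all \<open>x\<^sub>i\<^sup>n\<^sup>-\<^sup>1\<^sup>-\<^sup>m y\<^sub>j\<^sup>m\<close> with \<open>m < n\<close>. In matrix terms
  \<open>C = X Y / (b - a)\<close>, where \<open>X\<close> and \<open>Y\<close> are Vandermonde matrices of distinct points and so have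
  nonzero determinant (\<open>det_monomials_nonzero\<close>). Squaring the sum and reducing exponents with
  \<open>x\<^sub>i\<^sup>n = - a\<close> and \<open>y\<^sub>j\<^sup>n = - b\<close> (\<open>diff_times_weighted_power_sum\<close>) gives, after multiplying row \<open>i\<close>
  of \<open>S\<close> by \<open>x\<^sub>i\<close>, the factorisation \<open>X D Y / (b - a)\<^sup>2\<close> with the diagonal matrix \<open>D\<close> of entries
  \<open>- ((m + 1) a + (n - 1 - m) b)\<close>. The product of the row factors \<open>x\<^sub>i\<close> is \<open>(-1)\<^sup>n a\<close>
  (\<open>prod_roots_power_plus\<close>). Dividing the determinants therefore leaves
  \<open>det D / ((-1)\<^sup>n a (b - a)\<^sup>n)\<close>, which is the asserted product
  (\<open>permanent_roots_power_plus\<close>).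

  The other expressions for the value follow by reversing this product and by pairing its factors
  from the two ends. The field embedding transports the value from \<open>K\<close> to the splitting field.
\<close>

section \<open>Borchardt's identity\<close>

lemma det_scale_rows:
  fixes c :: "nat \<Rightarrow> 'a :: comm_ring_1"
  shows "det (mat n n (\<lambda>(i, j). c i * f i j)) = (\<Prod>i = 0..<n. c i) * det (mat n n (\<lambda>(i, j). f i j))"
proof -
  have "(\<Prod>i = 0..<n. mat n n (\<lambda>(i, j). c i * f i j) $$ (i, p i)) =
        (\<Prod>i = 0..<n. c i) * (\<Prod>i = 0..<n. mat n n (\<lambda>(i, j). f i j) $$ (i, p i))"
    if "p permutes {0..<n}" for p
    unfolding prod.distrib[symmetric]
    using permutes_in_image[OF that] by (intro prod.cong) auto
  then show ?thesis
    by (simp add: det_def'[of _ n] sum_distrib_left mult.left_commute cong: sum.cong_simp)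
qed

text \<open>
  In the product of the two sums over permutations, group the pair of a permutation \<open>s\<close> from the
  determinant and \<open>t\<close> from the permanent by \<open>p = t \<circ> s\<^sup>-\<^sup>1\<close>: for fixed \<open>p\<close> the remaining sum over
  \<open>s\<close> is again a determinant.
\<close>
lemma det_times_permanent:
  fixes f g :: "nat \<Rightarrow> nat \<Rightarrow> 'a :: comm_ring_1"
  shows "det (mat n n (\<lambda>(i, j). f i j)) * permanent (mat n n (\<lambda>(i, j). g i j)) =
         (\<Sum>p | p permutes {0..<n}. det (mat n n (\<lambda>(i, j). f i j * g i (p j))))"
proof -
  let ?S = "{p. p permutes {0..<n}}"
  have det: "det (mat n n (\<lambda>(i, j). h i j)) = (\<Sum>s\<in>?S. signof s * (\<Prod>i = 0..<n. h i (s i)))"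
    for h :: "nat \<Rightarrow> nat \<Rightarrow> 'a"
    unfolding det_def'[OF mat_carrier]
    by (intro sum.cong arg_cong2[where f = "(*)"] prod.cong) (auto dest: permutes_in_image)
  have per: "permanent (mat n n (\<lambda>(i, j). g i j)) = (\<Sum>t\<in>?S. \<Prod>i = 0..<n. g i (t i))"
    unfolding permanent_def
    by (auto intro!: sum.cong prod.cong dest: permutes_in_image)
  have "det (mat n n (\<lambda>(i, j). f i j)) * permanent (mat n n (\<lambda>(i, j). g i j)) =
        (\<Sum>s\<in>?S. signof s * (\<Prod>i = 0..<n. f i (s i)) * (\<Sum>t\<in>?S. \<Prod>i = 0..<n. g i (t i)))"
    unfolding det per sum_distrib_right ..
  also have "\<dots> = (\<Sum>s\<in>?S. signof s * (\<Prod>i = 0..<n. f i (s i)) * (\<Sum>p\<in>?S. \<Prod>i = 0..<n. g i (p (s i))))"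
  proof (rule sum.cong[OF refl])
    fix s assume "s \<in> ?S"
    then have "(\<Sum>t\<in>?S. \<Prod>i = 0..<n. g i (t i)) = (\<Sum>p\<in>?S. \<Prod>i = 0..<n. g i (p (s i)))"
      using sum_permutations_compose_right[of s "{0..<n}" "\<lambda>t. \<Prod>i = 0..<n. g i (t i)"] by simp
    then show "signof s * (\<Prod>i = 0..<n. f i (s i)) * (\<Sum>t\<in>?S. \<Prod>i = 0..<n. g i (t i)) =
               signof s * (\<Prod>i = 0..<n. f i (s i)) * (\<Sum>p\<in>?S. \<Prod>i = 0..<n. g i (p (s i)))"
      by (rule arg_cong)
  qed
  also have "\<dots> = (\<Sum>s\<in>?S. \<Sum>p\<in>?S. signof s * (\<Prod>i = 0..<n. f i (s i) * g i (p (s i))))"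
    by (simp add: sum_distrib_left prod.distrib mult.assoc)
  also have "\<dots> = (\<Sum>p\<in>?S. \<Sum>s\<in>?S. signof s * (\<Prod>i = 0..<n. f i (s i) * g i (p (s i))))"
    by (rule sum.swap)
  also have "\<dots> = (\<Sum>p\<in>?S. det (mat n n (\<lambda>(i, j). f i j * g i (p j))))"
    unfolding det ..
  finally show ?thesis .
qed

text \<open>
  In the expansion of the left-hand side only the identity permutation survives. For every other
  \<open>p\<close>, column \<open>j\<close> of the matrix, multiplied by \<open>y j - y (p j)\<close>, is by partial fractions the
  difference of the columns \<open>j\<close> and \<open>p j\<close> of the Cauchy matrix. These differences sum to zero,
  because \<open>p\<close> permutes the columns, and some factor \<open>y j - y (p j)\<close> is not zero; hence the
  columns are linearly dependent.
\<close>
theorem borchardt_identity: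
  fixes x y :: "nat \<Rightarrow> 'a :: field"
  assumes inj: "inj_on y {0..<n}"
    and ne: "\<And>i j. i < n \<Longrightarrow> j < n \<Longrightarrow> x i \<noteq> y j"
  shows "det (mat n n (\<lambda>(i, j). 1 / (x i - y j))) * permanent (mat n n (\<lambda>(i, j). 1 / (x i - y j))) =
         det (mat n n (\<lambda>(i, j). 1 / (x i - y j)\<^sup>2))"
proof -
  let ?M = "\<lambda>p. mat n n (\<lambda>(i, j). 1 / (x i - y j) * (1 / (x i - y (p j))))"
  have vanish: "det (?M p) = 0" if p: "p permutes {0..<n}" and "p \<noteq> id" for p
  proof -
    from \<open>p \<noteq> id\<close> obtain j where j: "p j \<noteq> j" by fastforce
    have jn: "j < n" using p j by (meson atLeastLessThan_iff permutes_not_in zero_le)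
    have pn: "p k < n" if "k < n" for k using permutes_in_image[OF p, of k] that by simp
    let ?v = "vec n (\<lambda>j. y j - y (p j))"
    have "?v $ j \<noteq> 0"
      using inj jn pn[OF jn] j by (auto dest: inj_onD)
    then have v0: "?v \<noteq> 0\<^sub>v n" using jn by (metis index_zero_vec(1))
    \<comment> \<open>At a fixed point of \<open>p\<close> both sides are zero, so no case distinction arises.\<close>
    have entry: "1 / (x i - y k) * (1 / (x i - y (p k))) * (y k - y (p k)) =
                 1 / (x i - y k) - 1 / (x i - y (p k))" if "i < n" "k < n" for i k
      using ne[OF that] ne[OF that(1) pn[OF that(2)]] by (simp add: field_simps)
    have "?M p *\<^sub>v ?v = 0\<^sub>v n"
    proof (intro eq_vecI)
      fix i assume i: "i < dim_vec (0\<^sub>v n :: 'a vec)"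
      have "(?M p *\<^sub>v ?v) $ i =
            (\<Sum>k = 0..<n. 1 / (x i - y k) * (1 / (x i - y (p k))) * (y k - y (p k)))"
        using i by (simp add: scalar_prod_def)
      also have "\<dots> = (\<Sum>k = 0..<n. 1 / (x i - y k)) - (\<Sum>k = 0..<n. 1 / (x i - y (p k)))"
        using i unfolding sum_subtractf[symmetric] by (intro sum.cong refl entry) auto
      also have "(\<Sum>k = 0..<n. 1 / (x i - y (p k))) = (\<Sum>k = 0..<n. 1 / (x i - y k))"
        using sum.permute[OF p, of "\<lambda>k. 1 / (x i - y k)"] by (simp add: o_def)
      finally show "(?M p *\<^sub>v ?v) $ i = 0\<^sub>v n $ i" using i by simp
    qed auto
    then show ?thesis
      using v0 by (subst det_0_iff_vec_prod_zero_field[of _ n]) (auto intro!: exI[of _ ?v])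
  qed
  have "det (mat n n (\<lambda>(i, j). 1 / (x i - y j))) * permanent (mat n n (\<lambda>(i, j). 1 / (x i - y j))) =
        (\<Sum>p | p permutes {0..<n}. det (?M p))"
    by (rule det_times_permanent)
  also have "\<dots> = (\<Sum>p\<in>{id}. det (?M p))"
  proof (rule sum.mono_neutral_right)
    show "\<forall>p\<in>{p. p permutes {0..<n}} - {id}. det (?M p) = 0" using vanish by blast
  qed (auto simp: finite_permutations permutes_id)
  finally show ?thesis by (simp add: power2_eq_square)
qed

section \<open>Factorising the Cauchy matrix of two root sets\<close>

text \<open>
  A Vandermonde determinant with its columns permuted by \<open>e\<close>. A vector in the kernel is the
  coefficient list of a polynomial of degree below \<open>n\<close> that has the \<open>n\<close> roots \<open>x i\<close>.
  The permutation makes it possible to use ascending and descending powers without tracking a sign.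
\<close>
lemma det_monomials_nonzero:
  fixes x :: "nat \<Rightarrow> 'a :: field"
  assumes x: "inj_on x {0..<n}" and e: "inj_on e {0..<n}" and en: "\<And>k. k < n \<Longrightarrow> e k < n"
  shows "det (mat n n (\<lambda>(i, k). x i ^ e k)) \<noteq> 0"
proof
  let ?V = "mat n n (\<lambda>(i, k). x i ^ e k)"
  assume "det ?V = 0"
  then obtain v where v: "v \<in> carrier_vec n" "v \<noteq> 0\<^sub>v n" and Vv: "?V *\<^sub>v v = 0\<^sub>v n"
    using det_0_iff_vec_prod_zero_field[of ?V n] by auto
  define q where "q = (\<Sum>k = 0..<n. Polynomial.monom (v $ k) (e k))"
  have root: "poly q (x i) = 0" if "i < n" for i
  proof -
    have "poly q (x i) = (?V *\<^sub>v v) $ i"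
      using that v(1) by (simp add: q_def poly_sum poly_monom scalar_prod_def mult.commute)
    then show ?thesis using that Vv by simp
  qed
  have "n > 0" using v by (cases n) auto
  have "degree q < n"
    unfolding q_def using \<open>n > 0\<close> en
    by (intro degree_sum_less) (auto intro: le_less_trans[OF degree_monom_le])
  then have "q = 0"
    using root \<open>n > 0\<close> card_image[OF x] by (intro poly_eqI_degree[of "x ` {0..<n}"]) auto
  have "v $ k = 0" if "k < n" for k
  proof -
    have "coeff q (e k) = (\<Sum>l = 0..<n. if l = k then v $ l else 0)"
      unfolding q_def coeff_sum using that inj_onD[OF e, of _ k] by (intro sum.cong) auto
    then show ?thesis using that \<open>q = 0\<close> by simp
  qed
  then have "v = 0\<^sub>v n" using v(1) by (intro eq_vecI) auto
  with v(2) show False ..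
qed

lemma prod_uminus:
  fixes f :: "'b \<Rightarrow> 'a :: comm_ring_1"
  shows "(\<Prod>i\<in>A. - f i) = (-1) ^ card A * (\<Prod>i\<in>A. f i)"
  using prod.distrib[of "\<lambda>_. -1" f A] by simp

text \<open>
  Vieta's formula for the constant term: being distinct, the \<open>x i\<close> are all the roots of \<open>X\<^sup>n + a\<close>.
\<close>
lemma prod_roots_power_plus:
  fixes x :: "nat \<Rightarrow> 'a :: field"
  assumes "n > 0" and inj: "inj_on x {0..<n}" and root: "\<And>i. i < n \<Longrightarrow> x i ^ n = - a"
  shows "(\<Prod>i = 0..<n. x i) = (-1) ^ n * a"
proof -
  let ?P = "Polynomial.monom 1 n + [:a:]" and ?Q = "\<Prod>i = 0..<n. [:- x i, 1:]"
  have degQ: "degree ?Q = n"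
    by (subst degree_prod_eq_sum_degree) auto
  have monicQ: "lead_coeff ?Q = 1"
    by (subst lead_coeff_prod) simp
  have "?P = ?Q"
  proof (rule poly_eqI_degree_lead_coeff[of _ n _ "x ` {0..<n}"])
    show "coeff ?P n = coeff ?Q n"
      using degQ monicQ \<open>n > 0\<close> by (simp add: coeff_pCons split: nat.split)
    show "degree ?P \<le> n" by (intro degree_add_le) (auto simp: degree_monom_le)
    show "degree ?Q \<le> n" using degQ by simp
    show "n \<le> card (x ` {0..<n})" using card_image[OF inj] by simp
  next
    fix z assume "z \<in> x ` {0..<n}"
    then obtain i where i: "i < n" "z = x i" by auto
    have "poly ?Q z = 0" unfolding poly_prod using i by (intro prod_zero) auto
    then show "poly ?P z = poly ?Q z" using root i by (simp add: poly_monom)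
  qed
  then have "poly ?P 0 = poly ?Q 0" by simp
  then have "a = (-1) ^ n * (\<Prod>i = 0..<n. x i)"
    using \<open>n > 0\<close> by (simp add: poly_monom poly_prod prod_uminus power_0_left)
  then have "(-1) ^ n * a = ((-1) ^ n * (-1) ^ n) * (\<Prod>i = 0..<n. x i)" by (simp only: mult.assoc)
  then show ?thesis by (simp flip: power_mult_distrib)
qed

text \<open>
  Write \<open>g = (\<Sum>m<n. x ^ (n - 1 - m) * y ^ m)\<close>, so that \<open>(x - y) * g = x ^ n - y ^ n\<close>. The lemma says
  that the weighted sum equals \<open>x * g\<^sup>2\<close>, multiplied by \<open>x - y\<close>. In \<open>x * g\<^sup>2\<close> the monomials
  \<open>x ^ (2 * n - 1 - s) * y ^ s\<close> with \<open>s = m\<close> and \<open>s = n + m\<close> occur \<open>m + 1\<close> and \<open>n - 1 - m\<close> times;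
  collecting them splits off a factor \<open>x ^ n\<close> or \<open>y ^ n\<close>. When these powers are constants, only the
  \<open>n\<close> monomials \<open>x ^ (n - 1 - m) * y ^ m\<close> are left. The factor \<open>x\<close> is what makes the
  \<open>x\<close>-exponents in the collected sum run over the same range as in \<open>g\<close>.
\<close>
lemma diff_times_weighted_power_sum:
  fixes x y :: "'a :: comm_ring_1"
  shows "(x - y) * (\<Sum>m<n. (of_nat (m + 1) * x ^ n + of_nat (n - 1 - m) * y ^ n) * (x ^ (n - 1 - m) * y ^ m))
       = x * (x ^ n - y ^ n) * (\<Sum>m<n. x ^ (n - 1 - m) * y ^ m)"
proof -
  define g where "g n = (\<Sum>m<n. x ^ (n - 1 - m) * y ^ m)" for n
  define h where "h n = (\<Sum>m<n. of_nat (m + 1) * (x ^ (n - 1 - m) * y ^ m))" for n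
  have pow: "x ^ (n - m) = x * x ^ (n - 1 - m)" if "m < n" for m n
    using that by (simp add: Suc_diff_Suc flip: power_Suc)
  have g_Suc: "g (Suc n) = x * g n + y ^ n" for n
  proof -
    have "(\<Sum>m<n. x ^ (n - m) * y ^ m) = (\<Sum>m<n. x * (x ^ (n - 1 - m) * y ^ m))"
      by (intro sum.cong refl) (simp add: Suc_diff_Suc flip: power_Suc mult.assoc)
    then show ?thesis unfolding g_def by (simp add: sum_distrib_left)
  qed
  have h_Suc: "h (Suc n) = x * h n + of_nat (n + 1) * y ^ n" for n
  proof -
    have "(\<Sum>m<n. of_nat (m + 1) * (x ^ (n - m) * y ^ m)) = (\<Sum>m<n. x * (of_nat (m + 1) * (x ^ (n - 1 - m) * y ^ m)))"
      by (intro sum.cong refl) (simp add: pow mult_ac)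
    then show ?thesis unfolding h_def by (simp add: sum_distrib_left)
  qed
  have g: "(x - y) * g n = x ^ n - y ^ n" for n
  proof (induction n)
    case (Suc n)
    have "(x - y) * g (Suc n) = x * ((x - y) * g n) + (x - y) * y ^ n"
      by (simp add: g_Suc algebra_simps)
    also have "\<dots> = x ^ Suc n - y ^ Suc n" unfolding Suc.IH by (simp add: algebra_simps)
    finally show ?case .
  qed (simp add: g_def)
  have h: "(x - y) * h n + of_nat n * y ^ n = x * g n" for n
  proof (induction n)
    case (Suc n)
    have "(x - y) * h (Suc n) + of_nat (Suc n) * y ^ Suc n = x * ((x - y) * h n + of_nat n * y ^ n) + x * y ^ n"
      by (simp add: h_Suc algebra_simps)
    also have "\<dots> = x * g (Suc n)" unfolding Suc.IH g_Suc by (simp add: algebra_simps)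
    finally show ?case .
  qed (simp add: g_def h_def)
  have "(\<Sum>m<n. (of_nat (m + 1) * x ^ n + of_nat (n - 1 - m) * y ^ n) * (x ^ (n - 1 - m) * y ^ m))
      = (\<Sum>m<n. x ^ n * (of_nat (m + 1) * (x ^ (n - 1 - m) * y ^ m)) +
           y ^ n * (of_nat n * (x ^ (n - 1 - m) * y ^ m) - of_nat (m + 1) * (x ^ (n - 1 - m) * y ^ m)))"
    by (intro sum.cong refl) (simp add: of_nat_diff algebra_simps)
  also have "\<dots> = x ^ n * h n + y ^ n * (of_nat n * g n - h n)"
    by (simp add: g_def h_def sum.distrib sum_subtractf flip: sum_distrib_left)
  finally have "(x - y) * (\<Sum>m<n. (of_nat (m + 1) * x ^ n + of_nat (n - 1 - m) * y ^ n) * (x ^ (n - 1 - m) * y ^ m))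
      = (x - y) * (x ^ n * h n + y ^ n * (of_nat n * g n - h n))"
    by (rule arg_cong)
  also have "\<dots> = (x ^ n - y ^ n) * ((x - y) * h n) + of_nat n * y ^ n * ((x - y) * g n)"
    by (simp add: algebra_simps)
  also have "\<dots> = (x ^ n - y ^ n) * ((x - y) * h n + of_nat n * y ^ n)"
    unfolding g by (simp add: algebra_simps)
  finally show ?thesis unfolding h by (simp add: g_def mult_ac)
qed

section \<open>The permanent\<close>

text \<open>
  Since \<open>x\<^sub>i ^ n - y\<^sub>j ^ n\<close> is the constant \<open>b - a\<close>, the Cauchy matrix is a scalar multiple of the
  product of the Vandermonde matrices in \<open>x\<close> and in \<open>y\<close>. Its entrywise square, with row \<open>i\<close>
  multiplied by \<open>x\<^sub>i\<close>, factors in the same way except for a diagonal matrix \<open>d\<close> in the middle. The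
  Vandermonde determinants cancel in the quotient of the two determinants, which is the permanent
  by Borchardt's identity.
\<close>
theorem permanent_roots_power_plus:
  fixes a b :: "'a :: field" and x y :: "nat \<Rightarrow> 'a"
  assumes "n > 0" and "a \<noteq> 0" and "a \<noteq> b"
    and x: "inj_on x {0..<n}" "\<And>i. i < n \<Longrightarrow> x i ^ n = - a"
    and y: "inj_on y {0..<n}" "\<And>j. j < n \<Longrightarrow> y j ^ n = - b"
  shows "permanent (mat n n (\<lambda>(i, j). 1 / (x i - y j))) =
         of_nat n / (b - a) ^ n * (\<Prod>k = 1..n - 1. of_nat n * b + of_nat k * (a - b))"
proof -
  define c where "c = b - a"
  define d where "d m = - (of_nat (m + 1) * a + of_nat (n - 1 - m) * b)" for m
  have "c \<noteq> 0" using \<open>a \<noteq> b\<close> by (simp add: c_def)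
  have power_diff: "x i ^ n - y j ^ n = c" if "i < n" "j < n" for i j
    using that by (simp add: x(2) y(2) c_def)
  have ne: "x i \<noteq> y j" if "i < n" "j < n" for i j
    using power_diff[OF that] \<open>c \<noteq> 0\<close> by auto

  let ?C = "mat n n (\<lambda>(i, j). 1 / (x i - y j))"
  let ?S = "mat n n (\<lambda>(i, j). 1 / (x i - y j)\<^sup>2)"
  let ?X = "mat n n (\<lambda>(i, k). x i ^ (n - 1 - k))"
  let ?Y = "mat n n (\<lambda>(k, j). y j ^ k)"

  have geom: "(x i - y j) * (\<Sum>m<n. x i ^ (n - 1 - m) * y j ^ m) = c" if "i < n" "j < n" for i j
    using power_diff_sumr2[of "x i" n "y j"] power_diff[OF that]
      sum.nat_diff_reindex[of "\<lambda>m. x i ^ m * y j ^ (n - Suc m)" n]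
    by (simp add: mult.commute)
  have C: "1 / (x i - y j) = 1 / c * (\<Sum>m<n. x i ^ (n - 1 - m) * y j ^ m)" if "i < n" "j < n" for i j
    using geom[OF that] ne[OF that] \<open>c \<noteq> 0\<close> by (simp add: field_simps)
  have S: "x i / (x i - y j)\<^sup>2 = (1 / c)\<^sup>2 * (\<Sum>m<n. d m * (x i ^ (n - 1 - m) * y j ^ m))"
    if ij: "i < n" "j < n" for i j
  proof -
    have "(x i - y j) * (\<Sum>m<n. d m * (x i ^ (n - 1 - m) * y j ^ m)) =
          x i * c * (\<Sum>m<n. x i ^ (n - 1 - m) * y j ^ m)"
      using diff_times_weighted_power_sum[of "x i" "y j" n] power_diff[OF ij] ij
      by (simp add: x(2) y(2) d_def)
    then have "(x i - y j)\<^sup>2 * (\<Sum>m<n. d m * (x i ^ (n - 1 - m) * y j ^ m)) =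
          x i * c * ((x i - y j) * (\<Sum>m<n. x i ^ (n - 1 - m) * y j ^ m))"
      by (simp add: power2_eq_square mult_ac)
    also have "\<dots> = x i * c\<^sup>2"
      unfolding geom[OF ij] by (simp add: power2_eq_square)
    finally show ?thesis
      using ne[OF ij] \<open>c \<noteq> 0\<close> by (simp add: field_simps)
  qed

  have "?C = (1 / c) \<cdot>\<^sub>m (?X * ?Y)"
    by (rule eq_matI) (simp_all add: C scalar_prod_def lessThan_atLeast0)
  then have detC: "det ?C = (1 / c) ^ n * (det ?X * det ?Y)"
    by (simp add: det_mult[of _ n])
  have "mat n n (\<lambda>(i, j). x i * (1 / (x i - y j)\<^sup>2)) =
        (1 / c)\<^sup>2 \<cdot>\<^sub>m (?X * mat n n (\<lambda>(k, j). d k * y j ^ k))"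
    by (rule eq_matI) (simp_all add: S scalar_prod_def lessThan_atLeast0 mult_ac)
  then have "(\<Prod>i = 0..<n. x i) * det ?S =
      ((1 / c)\<^sup>2) ^ n * (det ?X * ((\<Prod>k = 0..<n. d k) * det ?Y))"
    unfolding det_scale_rows[symmetric] by (simp add: det_mult[of _ n])
  then have detS: "(\<Prod>i = 0..<n. x i) * det ?S = (1 / c) ^ n * (\<Prod>k = 0..<n. d k) * det ?C"
    unfolding detC power2_eq_square power_mult_distrib by (simp only: mult_ac)

  \<comment> \<open>The last entry \<open>- n * a\<close> supplies the \<open>a\<close> and the minus signs of all entries the \<open>(-1) ^ n\<close>
     of \<open>(-1) ^ n * a\<close>, the product of the \<open>x i\<close>.\<close>
  have "(\<Prod>k = 0..<n. d k) = (-1) ^ n * (\<Prod>k = 0..<n. of_nat (k + 1) * a + of_nat (n - 1 - k) * b)"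
    unfolding d_def prod_uminus by simp
  also have "(\<Prod>k = 0..<n. of_nat (k + 1) * a + of_nat (n - 1 - k) * b) =
             (\<Prod>k = 1..n. of_nat k * a + of_nat (n - k) * b)"
    by (rule prod.reindex_bij_witness[of _ "\<lambda>k. k - 1" Suc]) auto
  also have "\<dots> = (\<Prod>k = 1..n. of_nat n * b + of_nat k * (a - b))"
    by (intro prod.cong refl) (auto simp: of_nat_diff algebra_simps)
  also have "\<dots> = of_nat n * a * (\<Prod>k = 1..n - 1. of_nat n * b + of_nat k * (a - b))"
    using \<open>n > 0\<close> by (cases n) (simp_all add: algebra_simps)
  finally have prod_d: "(\<Prod>k = 0..<n. d k) =
    (\<Prod>i = 0..<n. x i) * (of_nat n * (\<Prod>k = 1..n - 1. of_nat n * b + of_nat k * (a - b)))"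
    using prod_roots_power_plus[OF \<open>n > 0\<close> x] by (simp add: mult_ac)
  have prod_x: "(\<Prod>i = 0..<n. x i) \<noteq> 0"
    using prod_roots_power_plus[OF \<open>n > 0\<close> x] \<open>a \<noteq> 0\<close> by simp

  have "transpose_mat ?Y = mat n n (\<lambda>(i, k). y i ^ k)" by auto
  then have "det ?Y \<noteq> 0"
    using det_monomials_nonzero[OF y(1), of "\<lambda>k. k"] det_transpose[of ?Y n] by simp
  moreover have "det ?X \<noteq> 0"
    by (rule det_monomials_nonzero[OF x(1)]) (auto simp: inj_on_def)
  ultimately have "det ?C \<noteq> 0" using \<open>c \<noteq> 0\<close> by (simp add: detC)
  have "det ?C * permanent ?C = det ?S"
    by (rule borchardt_identity) (use y(1) ne in auto)
  then have "(\<Prod>i = 0..<n. x i) * (det ?C * permanent ?C) = (\<Prod>i = 0..<n. x i) * (det ?C *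
      (of_nat n / c ^ n * (\<Prod>k = 1..n - 1. of_nat n * b + of_nat k * (a - b))))"
    by (simp only: detS prod_d) (simp add: power_divide mult_ac)
  then show ?thesis unfolding mult_left_cancel[OF prod_x] mult_left_cancel[OF \<open>det ?C \<noteq> 0\<close>] c_def .
qed

section \<open>Rewriting the product of an arithmetic progression\<close>

lemma prod_fold_even:
  fixes f :: "nat \<Rightarrow> 'a :: comm_monoid_mult"
  shows "(\<Prod>k = 1..2 * m. f k) = (\<Prod>k = 1..m. f k * f (2 * m + 1 - k))"
proof -
  have "(\<Prod>k = 1..2 * m. f k) = (\<Prod>k = 1..m. f k) * (\<Prod>k = m + 1..2 * m. f k)"
    using prod.ub_add_nat[of 1 m f m] by (simp add: mult_2)
  also have "(\<Prod>k = m + 1..2 * m. f k) = (\<Prod>k = 1..m. f (2 * m + 1 - k))"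
    by (rule prod.reindex_bij_witness[of _ "\<lambda>k. 2 * m + 1 - k" "\<lambda>k. 2 * m + 1 - k"]) auto
  finally show ?thesis by (simp add: prod.distrib)
qed

lemma prod_fold_odd:
  fixes f :: "nat \<Rightarrow> 'a :: comm_monoid_mult"
  shows "(\<Prod>k = 1..2 * m + 1. f k) = f (m + 1) * (\<Prod>k = 1..m. f k * f (2 * m + 2 - k))"
proof -
  have "(\<Prod>k = 1..2 * m + 1. f k) = (\<Prod>k = 1..m. f k) * (\<Prod>k = m + 1..2 * m + 1. f k)"
    using prod.ub_add_nat[of 1 m f "m + 1"] by (simp add: mult_2)
  also have "(\<Prod>k = m + 1..2 * m + 1. f k) = f (m + 1) * (\<Prod>k = m + 2..2 * m + 1. f k)"
    by (subst prod.atLeast_Suc_atMost) simp_all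
  also have "(\<Prod>k = m + 2..2 * m + 1. f k) = (\<Prod>k = 1..m. f (2 * m + 2 - k))"
    by (rule prod.reindex_bij_witness[of _ "\<lambda>k. 2 * m + 2 - k" "\<lambda>k. 2 * m + 2 - k"]) auto
  finally show ?thesis by (simp add: prod.distrib mult_ac)
qed

text \<open>
  All forms of the product come from the symmetry \<open>k \<mapsto> n - k\<close>, which turns
  \<open>n * b + k * (a - b)\<close> into \<open>n * a + k * (b - a)\<close>. It reverses the product; it also pairs the factors
  \<open>k\<close> and \<open>n - k\<close>, leaving for even \<open>n\<close> the middle factor at \<open>k = n div 2\<close>.
\<close>
lemma prod_arith_rev:
  fixes a b :: "'a :: comm_ring_1"
  shows "(\<Prod>k = 1..n - 1. of_nat n * a + of_nat k * (b - a)) =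
         (\<Prod>k = 1..n - 1. of_nat n * b + of_nat k * (a - b))"
  by (rule prod.reindex_bij_witness[of _ "\<lambda>k. n - k" "\<lambda>k. n - k"])
     (auto simp: of_nat_diff algebra_simps)

lemma prod_arith_odd:
  fixes a b :: "'a :: comm_ring_1"
  assumes "odd n"
  shows "(\<Prod>k = 1..n - 1. of_nat n * b + of_nat k * (a - b)) =
         (- 1) ^ ((n - 1) div 2) * (\<Prod>k = 1..(n - 1) div 2.
            (- of_nat n * a - of_nat k * (b - a)) * (of_nat n * b - of_nat k * (b - a)))"
proof -
  from assms obtain m where n: "n = 2 * m + 1" by (rule oddE)
  have "(\<Prod>k = 1..2 * m. of_nat n * b + of_nat k * (a - b)) =
        (\<Prod>k = 1..m. - ((- of_nat n * a - of_nat k * (b - a)) * (of_nat n * b - of_nat k * (b - a))))"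
    unfolding prod_fold_even
    by (intro prod.cong refl) (auto simp: n of_nat_diff algebra_simps)
  then show ?thesis by (simp add: n prod_uminus)
qed

lemma prod_arith_even:
  fixes a b :: "'a :: field"
  assumes "even n" and "n > 0" and "(2 :: 'a) \<noteq> 0"
  shows "(\<Prod>k = 1..n - 1. of_nat n * b + of_nat k * (a - b)) =
         of_nat n / 2 * (a + b) * (\<Prod>k = 1..n div 2 - 1.
            (of_nat n * a + of_nat k * (b - a)) * (of_nat n * b + of_nat k * (a - b)))"
proof -
  from assms(1,2) obtain m where n: "n = 2 * m + 2"
    by (metis add.commute add_2_eq_Suc' dvd_def gr0_implies_Suc mult_Suc_right nat_0_less_mult_iff)
  have rev: "of_nat n * b + of_nat (2 * m + 2 - k) * (a - b) = of_nat n * a + of_nat k * (b - a)"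
    if "k \<in> {1..m}" for k
    using that by (simp add: n of_nat_diff algebra_simps)
  have "(\<Prod>k = 1..2 * m + 1. of_nat n * b + of_nat k * (a - b)) =
        (of_nat n * b + of_nat (m + 1) * (a - b)) * (\<Prod>k = 1..m.
            (of_nat n * a + of_nat k * (b - a)) * (of_nat n * b + of_nat k * (a - b)))"
    unfolding prod_fold_odd
    by (rule arg_cong[OF prod.cong[OF refl]], subst rev, assumption, rule mult.commute)
  moreover have "of_nat n * b + of_nat (m + 1) * (a - b) = of_nat n / 2 * (a + b)"
    using assms(3) by (simp add: n field_simps)
  moreover have "n - 1 = 2 * m + 1" "n div 2 - 1 = m" using n by auto
  ultimately show ?thesis by (simp only:)
qed

section \<open>Roots in a splitting field\<close>

theorem theorem3:
  fixes n :: nat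
    and a b :: "'k :: field"
    and h :: "'k \<Rightarrow> 'l :: field"
    and L :: "'l set"
    and x y :: "nat \<Rightarrow> 'l"
  assumes "n \<ge> 1"
    and "CHAR('k) = 0 \<or> coprime CHAR('k) n"
    and "a \<noteq> 0" and "b \<noteq> 0" and "a \<noteq> b"
    and "is_splitting_field h
           ((Polynomial.monom 1 n + [:a:]) * (Polynomial.monom 1 n + [:b:])) L"
    and "bij_betw x {0..<n} {z \<in> L. poly (map_poly h (Polynomial.monom 1 n + [:a:])) z = 0}"
    and "bij_betw y {0..<n} {z \<in> L. poly (map_poly h (Polynomial.monom 1 n + [:b:])) z = 0}"
  shows "permanent (mat n n (\<lambda>(i, j). 1 / (x i - y j))) =
           h (of_nat n / (b - a) ^ n * (\<Prod>k = 1..n - 1. of_nat n * a + of_nat k * (b - a)))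
       \<and> of_nat n / (b - a) ^ n * (\<Prod>k = 1..n - 1. of_nat n * a + of_nat k * (b - a)) =
         of_nat n / (b - a) ^ n * (\<Prod>k = 1..n - 1. of_nat n * b + of_nat k * (a - b))
       \<and> of_nat n / (b - a) ^ n * (\<Prod>k = 1..n - 1. of_nat n * b + of_nat k * (a - b)) =
         (if odd n then
            (- 1) ^ ((n - 1) div 2) * (of_nat n / (b - a) ^ n) *
            (\<Prod>k = 1..(n - 1) div 2.
               (- of_nat n * a - of_nat k * (b - a)) * (of_nat n * b - of_nat k * (b - a)))
          else
            of_nat n / 2 * (of_nat n * (a + b) / (b - a) ^ n) *
            (\<Prod>k = 1..n div 2 - 1.
               (of_nat n * a + of_nat k * (b - a)) * (of_nat n * b + of_nat k * (a - b))))"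
proof -
  interpret h: field_hom h using assms(6) by (simp add: is_splitting_field_def)
  have roots: "z ^ n = - h e"
    if "poly (map_poly h (Polynomial.monom 1 n + [:e:])) z = 0" for e z
  proof -
    have "map_poly h (Polynomial.monom 1 n + [:e:]) = Polynomial.monom 1 n + [:h e:]"
      by (rule poly_eqI) (simp add: coeff_map_poly coeff_pCons h.hom_add split: nat.split)
    then show ?thesis using that by (simp add: poly_monom eq_neg_iff_add_eq_0)
  qed
  have x: "inj_on x {0..<n}" "\<And>i. i < n \<Longrightarrow> x i ^ n = - h a"
    using assms(7) by (auto simp: bij_betw_def intro!: roots)
  have y: "inj_on y {0..<n}" "\<And>j. j < n \<Longrightarrow> y j ^ n = - h b"
    using assms(8) by (auto simp: bij_betw_def intro!: roots)
  have per: "permanent (mat n n (\<lambda>(i, j). 1 / (x i - y j))) =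
      h (of_nat n / (b - a) ^ n * (\<Prod>k = 1..n - 1. of_nat n * b + of_nat k * (a - b)))"
    using permanent_roots_power_plus[of n "h a" "h b" x y] assms(1,3,5) x y
    by (simp add: hom_distribs)
  \<comment> \<open>Coprimality of the characteristic with an even \<open>n\<close> excludes characteristic two.\<close>
  have two: "(2 :: 'k) \<noteq> 0" if "even n"
  proof
    assume "(2 :: 'k) = 0"
    then have "CHAR('k) dvd 2" using of_nat_eq_0_iff_char_dvd[of 2, where 'a = 'k] by simp
    then show False
      using assms(2) dvd_trans[OF _ that] by (auto simp: coprime_absorb_left)
  qed
  show ?thesis
  proof (intro conjI)
    show "permanent (mat n n (\<lambda>(i, j). 1 / (x i - y j))) =
        h (of_nat n / (b - a) ^ n * (\<Prod>k = 1..n - 1. of_nat n * a + of_nat k * (b - a)))"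
      unfolding per prod_arith_rev[of n a b] ..
  next
    show "of_nat n / (b - a) ^ n * (\<Prod>k = 1..n - 1. of_nat n * a + of_nat k * (b - a)) =
        of_nat n / (b - a) ^ n * (\<Prod>k = 1..n - 1. of_nat n * b + of_nat k * (a - b))"
      unfolding prod_arith_rev[of n a b] ..
  next
    show "of_nat n / (b - a) ^ n * (\<Prod>k = 1..n - 1. of_nat n * b + of_nat k * (a - b)) =
         (if odd n then
            (- 1) ^ ((n - 1) div 2) * (of_nat n / (b - a) ^ n) *
            (\<Prod>k = 1..(n - 1) div 2.
               (- of_nat n * a - of_nat k * (b - a)) * (of_nat n * b - of_nat k * (b - a)))
          else
            of_nat n / 2 * (of_nat n * (a + b) / (b - a) ^ n) *
            (\<Prod>k = 1..n div 2 - 1.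
               (of_nat n * a + of_nat k * (b - a)) * (of_nat n * b + of_nat k * (a - b))))"
    proof (cases "odd n")
      case True
      then show ?thesis unfolding prod_arith_odd[OF True] by (simp add: mult_ac)
    next
      case False
      then have "even n" "n > 0" using \<open>n \<ge> 1\<close> by auto
      then show ?thesis
        unfolding prod_arith_even[OF \<open>even n\<close> \<open>n > 0\<close> two[OF \<open>even n\<close>]] by (simp add: mult_ac)
    qed
  qed
qed

end
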